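(* Let $A\in\mathbb{R}^{m\times n}$, let $P$, $B=P^TA$ and $A_{(k)}$ be produced by the randomized algorithm described in the context with target rank $k$ and oversampling parameter $p$, $k+p\le\min\{m,n\}$, and let $\widetilde\sigma_1\ge\widetilde\sigma_2\ge\cdots\ge\widetilde\sigma_{k+p}$ be the singular values of $B$. Then $$\|A-A_{(k)}\|\le\widetilde\sigma_{k+1}+\|(I-PP^T)A\|$$ with $$\sigma_{m-p+1}\le\widetilde\sigma_{k+1}\le\sigma_{k+1}.$$
   Context: $\|\cdot\|$ is the matrix 2-norm. $A\in\mathbb{R}^{m\times n}$ is arbitrary ($m\ge n$ or $m\leq n$, singular values not necessarily simple), with singular values $\sigma_1\ge\sigma_2\ge\cdots\ge\sigma_{\min\{m,n\}}$, and by convention $\sigma_{\min\{m,n\}+1}=\cdots=\sigma_m=0$, so that $\sigma_1^2,\ldots,\sigma_m^2$ are the eigenvalues of $AA^T$. The integers $k\ge1$, $p\ge1$ satisfy $\ell=k+p\le\min\{m,n\}$. Randomized approximate SVD algorithm. Stage A: draw an $n\times\ell$ Gaussian random matrix $\Omega$; form $Y=A\Omega\in\mathbb{R}^{m\times\ell}$; compute the compact QR factorization $Y=PR$ with $P\in\mathbb{R}^{m\times\ell}$ having orthonormal columns. Stage B: form $B=P^TA\in\mathbb{R}^{\ell\times n}$; compute its compact SVD $B=\widetilde U\widetilde\Sigma\widetilde V^T$ (singular values in decreasing order); let $B_{(k)}=\widetilde U_k\widetilde\Sigma_{(k)}\widetilde V_k^T$ be the best rank $k$ approximation to $B$, where $\widetilde\Sigma_{(k)}$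 is the diagonal matrix of the first $k$ diagonal entries of $\widetilde\Sigma$ and $\widetilde U_k,\widetilde V_k$ are the first $k$ columns of $\widetilde U,\widetilde V$; output the truncated rank $k$ approximation $A_{(k)}=PB_{(k)}$. *)

theory Defs
  imports
    "HOL-Probability.Probability"
    "HOL-Computational_Algebra.Fundamental_Theorem_Algebra"
    "Jordan_Normal_Form.Char_Poly"
begin

definition euclidean_norm :: "real vec \<Rightarrow> real" where
  "euclidean_norm v = sqrt (scalar_prod v v)"

(* The operator norm induced by the Euclidean norms. The closed unit ball (instead of the
   unit sphere) keeps the index set nonempty for matrices without columns. *)
definition matrix_2_norm :: "real mat \<Rightarrow> real" where
  "matrix_2_norm A =
     (SUP x \<in> {x \<in> carrier_vec (dim_col A). euclidean_norm x \<le> 1}. euclidean_norm (A *\<^sub>v x))"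

(* All eigenvalues of A * A^T with algebraic multiplicity, in decreasing order. Since A * A^T
   is symmetric, its characteristic polynomial splits over the reals, so the length of this
   list is dim_row A. *)
definition gram_eigenvalues :: "real mat \<Rightarrow> real list" where
  "gram_eigenvalues A =
     rev (sorted_list_of_multiset (proots (char_poly (A * transpose_mat A))))"

(* The index j is one-based. For min (dim_row A) (dim_col A) < j \<le> dim_row A the value is 0,
   which is the convention for the indices beyond the smaller dimension. *)
definition singular_value :: "real mat \<Rightarrow> nat \<Rightarrow> real" where
  "singular_value A j =
     (if 1 \<le> j \<and> j \<le> length (gram_eigenvalues A) then sqrt (gram_eigenvalues A ! (j - 1)) else 0)"

definition orthonormal_columns :: "real mat \<Rightarrow> bool" where
  "orthonormal_columns Q \<longleftrightarrow> transpose_mat Q * Q = 1\<^sub>m (dim_col Q)"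

(* Y need not have full rank, so R may be singular and the factorization need not be unique. *)
definition compact_qr :: "real mat \<Rightarrow> real mat \<Rightarrow> real mat \<Rightarrow> bool" where
  "compact_qr Y P R \<longleftrightarrow>
     P \<in> carrier_mat (dim_row Y) (dim_col Y) \<and> orthonormal_columns P \<and>
     R \<in> carrier_mat (dim_col Y) (dim_col Y) \<and> upper_triangular R \<and>
     Y = P * R"

(* The number of columns of U and V is the smaller dimension of B, not its rank, so zero
   singular values are kept on the diagonal of S. *)
definition compact_svd :: "real mat \<Rightarrow> real mat \<Rightarrow> real mat \<Rightarrow> real mat \<Rightarrow> bool" where
  "compact_svd B U S V \<longleftrightarrow>
     (let r = min (dim_row B) (dim_col B) in
        U \<in> carrier_mat (dim_row B) r \<and> orthonormal_columns U \<and>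
        V \<in> carrier_mat (dim_col B) r \<and> orthonormal_columns V \<and>
        S \<in> carrier_mat r r \<and> diagonal_mat S \<and>
        (\<forall>i<r. 0 \<le> S $$ (i, i)) \<and>
        (\<forall>i j. i \<le> j \<and> j < r \<longrightarrow> S $$ (j, j) \<le> S $$ (i, i)) \<and>
        B = U * S * transpose_mat V)"

definition first_columns :: "nat \<Rightarrow> real mat \<Rightarrow> real mat" where
  "first_columns k Q = mat (dim_row Q) k (\<lambda>(i, j). Q $$ (i, j))"

definition leading_block :: "nat \<Rightarrow> real mat \<Rightarrow> real mat" where
  "leading_block k S = mat k k (\<lambda>(i, j). S $$ (i, j))"

(* An n x l matrix whose entries are independent standard normal random variables on M. *)
definition gaussian_random_matrix ::
    "'w measure \<Rightarrow> nat \<Rightarrow> nat \<Rightarrow> ('w \<Rightarrow> real mat) \<Rightarrow> bool" where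
  "gaussian_random_matrix M n l \<Omega> \<longleftrightarrow>
     prob_space M \<and>
     (\<forall>\<omega> \<in> space M. \<Omega> \<omega> \<in> carrier_mat n l) \<and>
     prob_space.indep_vars M (\<lambda>_. borel) (\<lambda>(i, j) \<omega>. \<Omega> \<omega> $$ (i, j)) ({..<n} \<times> {..<l}) \<and>
     (\<forall>i<n. \<forall>j<l. distributed M lborel (\<lambda>\<omega>. \<Omega> \<omega> $$ (i, j)) (\<lambda>x. ennreal (std_normal_density x)))"

(* For a drawn sample G of the Gaussian matrix, P, B and Ak are a possible outcome of the
   algorithm: a relation, because neither the QR factorization nor the SVD is unique. *)
definition randomized_svd ::
    "real mat \<Rightarrow> nat \<Rightarrow> real mat \<Rightarrow> real mat \<Rightarrow> real mat \<Rightarrow> real mat \<Rightarrow> bool" where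
  "randomized_svd A k G P B Ak \<longleftrightarrow>
     (\<exists>R U S V.
        compact_qr (A * G) P R \<and>
        B = transpose_mat P * A \<and>
        compact_svd B U S V \<and>
        Ak = P * (first_columns k U * leading_block k S * transpose_mat (first_columns k V)))"

end

theory Submission
  imports Defs
begin

text \<open>
  Error bound. Write \<open>B\<^sub>k\<close> for the truncated SVD of \<open>B = P\<^sup>T A\<close>. Then
  \<open>A - P B\<^sub>k = P (B - B\<^sub>k) + (I - P P\<^sup>T) A\<close>. Multiplication by \<open>P\<close> preserves norms, and
  \<open>B - B\<^sub>k\<close> is \<open>U\<close> times a diagonal matrix times \<open>V\<^sup>T\<close>, where the entries of the
  diagonal matrix lie between 0 and the entry of \<open>S\<close> with one-based index \<open>k + 1\<close>; that entry
  therefore bounds the norm of \<open>B - B\<^sub>k\<close>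
  (lemmas \<open>projection_error_le\<close>, \<open>truncated_svd\<close>, \<open>norm_mat_diag_mult_le\<close>).

  Singular values. The matrix \<open>B B\<^sup>T = P\<^sup>T (A A\<^sup>T) P\<close> is a compression of \<open>A A\<^sup>T\<close>, so Cauchy's
  interlacing inequalities (lemma \<open>compression_interlacing\<close>) bound its eigenvalues by those of
  \<open>A A\<^sup>T\<close> from both sides. They are proved by the usual dimension count: a span of
  eigenvectors of the compression, mapped by \<open>P\<close>, and a span of eigenvectors of \<open>A A\<^sup>T\<close> whose
  dimensions add up to more than \<open>m\<close> share a nonzero vector, on which the two quadratic forms
  are compared (lemma \<open>rayleigh_index\<close>). Interlacing for \<open>P = I\<close> says that ordered
  eigenvalues are unique, which identifies the diagonal of \<open>S\<close> with the singular values of \<open>B\<close>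
  (lemma \<open>singular_value_eqI\<close>).

  Singular values are defined through the real roots of a characteristic polynomial. That these
  roots are numerous enough and come with an orthonormal eigenbasis is the spectral theorem for
  real symmetric matrices: the complex roots of the characteristic polynomial are real
  (\<open>symmetric_char_poly_roots_real\<close>), hence it splits over the reals, and
  \<open>symmetric_diagonalization\<close> deflates one eigenvector at a time.
\<close>

\<comment> \<open>The dot now denotes only \<open>scalar_prod\<close>, and the dollar sign only \<open>vec_index\<close>.\<close>
no_notation inner (infix "\<bullet>" 70)
no_notation Finite_Cartesian_Product.vec_nth (infixl "$" 90)

section \<open>Euclidean norm and matrix 2-norm\<close>

lemma euclidean_norm_L2_set:
  "euclidean_norm v = L2_set (vec_index v) {0..<dim_vec v}"
  by (simp add: euclidean_norm_def L2_set_def scalar_prod_def power2_eq_square)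

lemma euclidean_norm_nonneg [simp]: "0 \<le> euclidean_norm v"
  by (simp add: euclidean_norm_L2_set)

lemma euclidean_norm_square: "(euclidean_norm v)\<^sup>2 = v \<bullet> v"
  by (simp add: euclidean_norm_def scalar_prod_def sum_nonneg)

lemma scalar_prod_self_sum:
  fixes v :: "real vec"
  assumes "v \<in> carrier_vec n"
  shows "v \<bullet> v = (\<Sum>i<n. (v $ i)\<^sup>2)"
  using assms by (simp add: scalar_prod_def power2_eq_square atLeast0LessThan)

lemma scalar_prod_le_norms:
  assumes "v \<in> carrier_vec n" "w \<in> carrier_vec n"
  shows "\<bar>v \<bullet> w\<bar> \<le> euclidean_norm v * euclidean_norm w"
proof -
  have "\<bar>v \<bullet> w\<bar> \<le> (\<Sum>i\<in>{0..<n}. \<bar>v $ i\<bar> * \<bar>w $ i\<bar>)"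
    using assms by (auto simp: scalar_prod_def abs_mult intro: order_trans[OF sum_abs])
  also have "\<dots> \<le> euclidean_norm v * euclidean_norm w"
    using assms L2_set_mult_ineq[of "vec_index v" "vec_index w" "{0..<n}"]
    by (simp add: euclidean_norm_L2_set)
  finally show ?thesis .
qed

lemma euclidean_norm_add_le:
  assumes "v \<in> carrier_vec n" "w \<in> carrier_vec n"
  shows "euclidean_norm (v + w) \<le> euclidean_norm v + euclidean_norm w"
proof -
  have "euclidean_norm (v + w) = L2_set (\<lambda>i. v $ i + w $ i) {0..<n}"
    using assms by (auto simp: euclidean_norm_L2_set intro!: L2_set_cong)
  then show ?thesis
    using assms L2_set_triangle_ineq[of "vec_index v" "vec_index w" "{0..<n}"]
    by (simp add: euclidean_norm_L2_set)
qed

lemma orthonormal_columns_scalar_prod: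
  assumes Q: "Q \<in> carrier_mat m n" "orthonormal_columns Q"
    and x: "x \<in> carrier_vec n" and y: "y \<in> carrier_vec n"
  shows "(Q *\<^sub>v x) \<bullet> (Q *\<^sub>v y) = x \<bullet> y"
proof -
  have "(Q *\<^sub>v x) \<bullet> (Q *\<^sub>v y) = (transpose_mat Q *\<^sub>v (Q *\<^sub>v x)) \<bullet> y"
    using transpose_vec_mult_scalar[OF Q(1) y, of "Q *\<^sub>v x"] Q x by auto
  also have "transpose_mat Q *\<^sub>v (Q *\<^sub>v x) = (transpose_mat Q * Q) *\<^sub>v x"
    using Q x by (intro assoc_mult_mat_vec[symmetric]) auto
  also have "\<dots> = x"
    using Q x by (simp add: orthonormal_columns_def)
  finally show ?thesis .
qed

lemma orthonormal_columns_norm: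
  assumes "Q \<in> carrier_mat m n" "orthonormal_columns Q" "x \<in> carrier_vec n"
  shows "euclidean_norm (Q *\<^sub>v x) = euclidean_norm x"
  using orthonormal_columns_scalar_prod[OF assms assms(3)] by (simp add: euclidean_norm_def)

text \<open>Bessel's inequality.\<close>
lemma orthonormal_columns_transpose_norm_le:
  assumes Q: "Q \<in> carrier_mat m n" "orthonormal_columns Q" and x: "x \<in> carrier_vec m"
  shows "euclidean_norm (transpose_mat Q *\<^sub>v x) \<le> euclidean_norm x"
proof -
  define y where "y = transpose_mat Q *\<^sub>v x"
  have y: "y \<in> carrier_vec n" using Q x by (auto simp: y_def)
  \<comment> \<open>Move \<open>Q\<^sup>T\<close> to the other side, use Cauchy--Schwarz and cancel one factor \<open>|y|\<close>.\<close>
  have "(euclidean_norm y)\<^sup>2 = x \<bullet> (Q *\<^sub>v y)"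
    using transpose_vec_mult_scalar[OF Q(1) y x] by (simp add: euclidean_norm_square y_def)
  also have "\<dots> \<le> euclidean_norm x * euclidean_norm (Q *\<^sub>v y)"
    using scalar_prod_le_norms[OF x, of "Q *\<^sub>v y"] Q y by auto
  also have "\<dots> = euclidean_norm x * euclidean_norm y"
    by (simp add: orthonormal_columns_norm[OF Q y])
  finally show ?thesis
    unfolding y_def[symmetric] power2_eq_square
    by (metis euclidean_norm_nonneg less_eq_real_def mult_right_le_imp_le)
qed

text \<open>The supremum in \<open>matrix_2_norm\<close> is a genuine one: the norms of the rows add up to a bound.\<close>
lemma bdd_above_matrix_2_norm:
  "bdd_above ((\<lambda>x. euclidean_norm (A *\<^sub>v x)) `
     {x \<in> carrier_vec (dim_col A). euclidean_norm x \<le> 1})"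
proof (rule bdd_aboveI2)
  fix x assume "x \<in> {x \<in> carrier_vec (dim_col A). euclidean_norm x \<le> 1}"
  then have x: "x \<in> carrier_vec (dim_col A)" and x1: "euclidean_norm x \<le> 1" by auto
  have "euclidean_norm (A *\<^sub>v x) = L2_set (\<lambda>i. row A i \<bullet> x) {0..<dim_row A}"
    by (auto simp: euclidean_norm_L2_set intro!: L2_set_cong)
  also have "\<dots> \<le> (\<Sum>i\<in>{0..<dim_row A}. \<bar>row A i \<bullet> x\<bar>)"
    by (rule L2_set_le_sum_abs)
  also have "\<dots> \<le> (\<Sum>i\<in>{0..<dim_row A}. euclidean_norm (row A i))"
  proof (rule sum_mono)
    fix i assume "i \<in> {0..<dim_row A}"
    have "\<bar>row A i \<bullet> x\<bar> \<le> euclidean_norm (row A i) * euclidean_norm x"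
      using x by (intro scalar_prod_le_norms[of _ "dim_col A"]) auto
    also have "\<dots> \<le> euclidean_norm (row A i) * 1"
      using x1 by (intro mult_left_mono) auto
    finally show "\<bar>row A i \<bullet> x\<bar> \<le> euclidean_norm (row A i)" by simp
  qed
  finally show "euclidean_norm (A *\<^sub>v x) \<le> (\<Sum>i\<in>{0..<dim_row A}. euclidean_norm (row A i))" .
qed

lemma norm_le_matrix_2_norm:
  assumes "x \<in> carrier_vec (dim_col A)" "euclidean_norm x \<le> 1"
  shows "euclidean_norm (A *\<^sub>v x) \<le> matrix_2_norm A"
  unfolding matrix_2_norm_def using assms
  by (intro cSUP_upper bdd_above_matrix_2_norm) auto

lemma matrix_2_norm_le:
  assumes "\<And>x. x \<in> carrier_vec (dim_col A) \<Longrightarrow> euclidean_norm x \<le> 1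
             \<Longrightarrow> euclidean_norm (A *\<^sub>v x) \<le> c"
  shows "matrix_2_norm A \<le> c"
  unfolding matrix_2_norm_def
proof (rule cSUP_least)
  have "0\<^sub>v (dim_col A) \<in> {x \<in> carrier_vec (dim_col A). euclidean_norm x \<le> 1}"
    by (simp add: euclidean_norm_def)
  then show "{x \<in> carrier_vec (dim_col A). euclidean_norm x \<le> 1} \<noteq> {}" by blast
qed (use assms in auto)

section \<open>The spectral theorem for real symmetric matrices\<close>

lemma real_poly_split:
  fixes p :: "real poly"
  assumes "p \<noteq> 0" and "\<And>z :: complex. poly (map_poly of_real p) z = 0 \<Longrightarrow> z \<in> \<real>"
  shows "Polynomial.smult (lead_coeff p) (\<Prod>x\<in>#proots p. [:-x, 1:]) = p"
  using assms
proof (induction "degree p" arbitrary: p)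
  case 0
  then obtain c where "p = [:c:]" by (metis degree_eq_zeroE)
  then show ?case by simp
next
  case (Suc n)
  interpret of_real: map_poly_comm_ring_hom complex_of_real ..
  have "\<not> constant (poly (map_poly complex_of_real p))"
    using Suc.hyps(2) by (simp add: constant_degree)
  then obtain z where z: "poly (map_poly complex_of_real p) z = 0"
    using fundamental_theorem_of_algebra by blast
  then obtain r where r: "z = of_real r" using Suc.prems(2) Reals_cases by blast
  have "poly p r = 0"
    using z unfolding r by simp
  then obtain q where q: "p = [:-r, 1:] * q" by (metis dvdE poly_eq_0_iff_dvd)
  have "q \<noteq> 0" using q Suc.prems(1) by auto
  have split: "Polynomial.smult (lead_coeff q) (\<Prod>x\<in>#proots q. [:-x, 1:]) = q"
  proof (rule Suc.hyps(1))
    show "n = degree q"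
      using \<open>q \<noteq> 0\<close> Suc.hyps(2) unfolding q by (subst (asm) degree_mult_eq) auto
    fix z :: complex assume "poly (map_poly of_real q) z = 0"
    then show "z \<in> \<real>"
      using Suc.prems(2)[of z] unfolding q by (simp add: of_real.hom_mult del: mult_pCons_left)
  qed fact
  have "lead_coeff p = lead_coeff q" unfolding q lead_coeff_mult by simp
  moreover have "proots p = {#r#} + proots q"
    unfolding q using \<open>q \<noteq> 0\<close> by (subst proots_mult) auto
  ultimately have "Polynomial.smult (lead_coeff p) (\<Prod>x\<in>#proots p. [:-x, 1:])
      = [:-r, 1:] * Polynomial.smult (lead_coeff q) (\<Prod>x\<in>#proots q. [:-x, 1:])"
    by (simp del: mult_pCons_left)
  then show ?case by (simp only: split q[symmetric])
qed

text \<open>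
  If \<open>M v = z v\<close>, then \<open>z |v|\<^sup>2\<close> is the value \<open>S\<close> at \<open>v\<close> of the Hermitian form of \<open>M\<close>, which
  is its own conjugate.
\<close>
lemma symmetric_char_poly_roots_real:
  fixes M :: "real mat" and z :: complex
  assumes M: "M \<in> carrier_mat n n" and sym: "transpose_mat M = M"
    and z: "poly (map_poly of_real (char_poly M)) z = 0"
  shows "z \<in> \<real>"
proof -
  define C where "C = map_mat complex_of_real M"
  have C: "C \<in> carrier_mat n n" using M by (simp add: C_def)
  have "poly (char_poly C) z = 0"
    using z unfolding C_def of_real_hom.char_poly_hom[OF M] .
  then have "eigenvalue C z" by (simp add: eigenvalue_root_char_poly[OF C])
  then obtain v where v: "v \<in> carrier_vec n" "v \<noteq> 0\<^sub>v n" "C *\<^sub>v v = z \<cdot>\<^sub>v v"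
    using C by (auto simp: eigenvalue_def eigenvector_def)
  have Mij: "M $$ (j, i) = M $$ (i, j)" if "i < n" "j < n" for i j
    using sym M that by (metis carrier_matD index_transpose_mat(1))
  define S where "S = (\<Sum>i<n. \<Sum>j<n. cnj (v $ i) * (of_real (M $$ (i, j)) * v $ j))"
  define N where "N = (\<Sum>i<n. (cmod (v $ i))\<^sup>2)"
  have row: "(\<Sum>j<n. of_real (M $$ (i, j)) * v $ j) = z * v $ i" if "i < n" for i
  proof -
    have "(C *\<^sub>v v) $ i = (\<Sum>j<n. of_real (M $$ (i, j)) * v $ j)"
      using that v(1) M by (simp add: C_def scalar_prod_def atLeast0LessThan)
    then show ?thesis using that v by simp
  qed
  have "S = z * of_real N"
  proof -
    have "S = (\<Sum>i<n. cnj (v $ i) * (z * v $ i))"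
      unfolding S_def by (simp add: sum_distrib_left[symmetric] row)
    also have "\<dots> = z * of_real N"
      unfolding N_def of_real_sum sum_distrib_left
      by (intro sum.cong) (auto simp: complex_norm_square mult_ac simp del: of_real_power)
    finally show ?thesis .
  qed
  moreover have "cnj S = S"
  proof -
    have "cnj S = (\<Sum>i<n. \<Sum>j<n. v $ i * (of_real (M $$ (i, j)) * cnj (v $ j)))"
      by (simp add: S_def)
    also have "\<dots> = (\<Sum>j<n. \<Sum>i<n. v $ i * (of_real (M $$ (i, j)) * cnj (v $ j)))"
      by (rule sum.swap)
    also have "\<dots> = S"
      unfolding S_def by (intro sum.cong) (auto simp: Mij mult_ac)
    finally show ?thesis .
  qed
  moreover have "N \<noteq> 0"
  proof
    assume "N = 0"
    then have "\<forall>i<n. v $ i = 0"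
      by (auto simp: N_def sum_nonneg_eq_0_iff)
    then have "v = 0\<^sub>v n" using v(1) by (intro eq_vecI) auto
    then show False using v(2) by simp
  qed
  ultimately have "cnj z = z" by auto
  then show ?thesis by (simp add: Reals_cnj_iff)
qed

lemma symmetric_char_poly_split:
  fixes M :: "real mat"
  assumes M: "M \<in> carrier_mat n n" and sym: "transpose_mat M = M"
  shows "(\<Prod>x\<in>#proots (char_poly M). [:-x, 1:]) = char_poly M"
    and "size (proots (char_poly M)) = n"
proof -
  have mon: "lead_coeff (char_poly M) = 1" and deg: "degree (char_poly M) = n"
    using degree_monic_char_poly[OF M] by auto
  show split: "(\<Prod>x\<in>#proots (char_poly M). [:-x, 1:]) = char_poly M"
    using real_poly_split[of "char_poly M"] symmetric_char_poly_roots_real[OF M sym] mon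
    by (metis leading_coeff_0_iff smult_1_left zero_neq_one)
  have "degree (\<Prod>x\<in>#X. [:-x, 1:]) = size X" for X :: "real multiset"
  proof (induction X)
    case (add x X)
    have "(\<Prod>x\<in>#X. [:-x, 1:]) \<noteq> 0" by (auto simp: prod_mset_zero_iff)
    then show ?case using add by (simp add: degree_mult_eq del: mult_pCons_left)
  qed simp
  from this[of "proots (char_poly M)"] show "size (proots (char_poly M)) = n"
    by (simp only: split deg)
qed

text \<open>
  The Householder reflection \<open>I - (2 / |u|\<^sup>2) u u\<^sup>T\<close> with \<open>u = v - e\<^sub>0\<close> exchanges \<open>v\<close> and the
  first unit vector \<open>e\<^sub>0\<close>. For \<open>v = e\<^sub>0\<close> the convention \<open>2 / 0 = 0\<close> turns it into the identity.
\<close>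
lemma exists_orthogonal_first_column:
  fixes v :: "real vec"
  assumes v: "v \<in> carrier_vec n" and v1: "v \<bullet> v = 1" and n: "0 < n"
  obtains W where "W \<in> carrier_mat n n" "orthonormal_columns W" "col W 0 = v"
proof -
  define u where "u i = v $ i - (if i = 0 then 1 else 0)" for i
  define s where "s = (\<Sum>i<n. (u i)\<^sup>2)"
  define c where "c = 2 / s"
  define W where "W = mat n n (\<lambda>(i, j). (if i = j then 1 else 0) - c * u i * u j)"
  have W: "W \<in> carrier_mat n n" by (simp add: W_def)
  \<comment> \<open>Orthogonality reduces to this identity, which also holds for \<open>s = 0\<close>.\<close>
  have cs: "c * (c * s - 2) = 0" by (simp add: c_def)
  have "transpose_mat W * W = 1\<^sub>m n"
  proof (rule eq_matI)
    fix i j assume "i < dim_row (1\<^sub>m n :: real mat)" "j < dim_col (1\<^sub>m n :: real mat)"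
    then have ij: "i < n" "j < n" by auto
    have "(transpose_mat W * W) $$ (i, j) = (\<Sum>k<n. W $$ (k, i) * W $$ (k, j))"
      using W ij by (simp add: scalar_prod_def atLeast0LessThan)
    also have "\<dots> = (\<Sum>k<n. (if k = i then (if i = j then 1 else 0) else 0)
        - (if k = i then c * u i * u j else 0) - (if k = j then c * u i * u j else 0)
        + c * c * u i * u j * (u k)\<^sup>2)"
      using ij by (intro sum.cong) (auto simp: W_def power2_eq_square algebra_simps)
    also have "\<dots> = (if i = j then 1 else 0) - c * u i * u j - c * u i * u j + c * c * u i * u j * s"
      using ij by (simp add: sum.distrib sum_subtractf sum_distrib_left[symmetric] s_def)
    also have "\<dots> = (if i = j then 1 else 0) + u i * u j * (c * (c * s - 2))"
      by (simp add: algebra_simps)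
    also have "\<dots> = (1\<^sub>m n) $$ (i, j)" using ij by (simp only: cs) simp
    finally show "(transpose_mat W * W) $$ (i, j) = (1\<^sub>m n) $$ (i, j)" .
  qed (use W in auto)
  then have "orthonormal_columns W" using W by (simp add: orthonormal_columns_def)
  moreover have "col W 0 = v"
  proof (rule eq_vecI)
    fix i assume "i < dim_vec v"
    then have i: "i < n" using v by simp
    have "s = (\<Sum>k<n. (v $ k)\<^sup>2 - (if k = 0 then 2 * v $ 0 - 1 else 0))"
      unfolding s_def u_def by (intro sum.cong) (auto simp: power2_eq_square algebra_simps)
    also have "\<dots> = 2 - 2 * v $ 0"
      using n v1 by (simp add: sum_subtractf scalar_prod_self_sum[OF v])
    finally have s: "s = - 2 * u 0" by (simp add: u_def)
    have "c * u i * u 0 = - u i"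
    proof (cases "s = 0")
      case True
      then have "u i = 0" using i by (auto simp: s_def sum_nonneg_eq_0_iff)
      then show ?thesis by simp
    next
      case False
      then show ?thesis unfolding c_def using s by (simp add: field_simps)
    qed
    then show "col W 0 $ i = v $ i"
      using W i n by (simp add: W_def u_def)
  qed (use W v in auto)
  ultimately show ?thesis using that W by blast
qed

text \<open>
  The eigenvalues appear on the diagonal in the order of the given list. An orthogonal matrix whose
  first column is a unit eigenvector splits off the first eigenvalue; by symmetry the first row of
  the transformed matrix vanishes together with its first column, so the induction hypothesis
  applies to the remaining symmetric block.
\<close>
lemma symmetric_diagonalization:
  fixes M :: "real mat"
  assumes "M \<in> carrier_mat n n" "transpose_mat M = M"
    and "char_poly M = (\<Prod>e\<leftarrow>es. [:-e, 1:])"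
  shows "\<exists>Q. Q \<in> carrier_mat n n \<and> orthonormal_columns Q \<and>
           transpose_mat Q * M * Q = mat_diag n (\<lambda>i. es ! i)"
  using assms
proof (induction es arbitrary: n M)
  case Nil
  then have "n = 0" using degree_monic_char_poly[OF Nil(1)] by simp
  then show ?case using Nil(1)
    by (intro exI[of _ "1\<^sub>m 0"]) (auto simp: orthonormal_columns_def mat_diag_def)
next
  case (Cons e es n M)
  note M = Cons.prems(1) and sym = Cons.prems(2)
  have "eigenvalue M e"
    unfolding eigenvalue_root_char_poly[OF M] Cons.prems(3) by simp
  then obtain w where w: "w \<in> carrier_vec n" "w \<noteq> 0\<^sub>v n" "M *\<^sub>v w = e \<cdot>\<^sub>v w"
    using M by (auto simp: eigenvalue_def eigenvector_def)
  have ww: "0 < w \<bullet> w"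
  proof -
    have "\<exists>i<n. w $ i \<noteq> 0"
      using w(1,2) by (metis eq_vecI carrier_vecD index_zero_vec)
    then show ?thesis
      unfolding scalar_prod_self_sum[OF w(1)]
      by (auto intro: sum_pos2)
  qed
  obtain n1 where n: "n = Suc n1" using w(1,2)
    by (cases n) auto
  define v where "v = (1 / sqrt (w \<bullet> w)) \<cdot>\<^sub>v w"
  have v: "v \<in> carrier_vec n" using w by (simp add: v_def)
  have v1: "v \<bullet> v = 1" using w(1) ww by (simp add: v_def)
  have Mv: "M *\<^sub>v v = e \<cdot>\<^sub>v v"
    using w M by (simp add: v_def mult_mat_vec[OF M w(1)] smult_smult_assoc mult.commute)
  obtain W where W: "W \<in> carrier_mat n n" "orthonormal_columns W" "col W 0 = v"
    using exists_orthogonal_first_column[OF v v1] n by auto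
  let ?W' = "transpose_mat W"
  have W': "?W' \<in> carrier_mat n n" using W by simp
  have W'W: "?W' * W = 1\<^sub>m n" using W by (simp add: orthonormal_columns_def)
  have WW': "W * ?W' = 1\<^sub>m n" by (rule mat_mult_left_right_inverse[OF W' W(1) W'W])
  define A where "A = ?W' * M * W"
  have A: "A \<in> carrier_mat n n" using W W' M by (simp add: A_def)
  have A_sym: "transpose_mat A = A"
  proof -
    have "transpose_mat A = ?W' * transpose_mat (?W' * M)"
      unfolding A_def using W W' M by (intro transpose_mult) auto
    also have "transpose_mat (?W' * M) = M * W"
      using transpose_mult[OF W' M] sym by simp
    also have "?W' * (M * W) = A"
      unfolding A_def using W W' M by (simp add: assoc_mult_mat)
    finally show ?thesis .
  qed
  have col0: "A $$ (i, 0) = (if i = 0 then e else 0)" if i: "i < n" for i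
  proof -
    have "col A 0 = (?W' * M) *\<^sub>v v"
      unfolding A_def W(3)[symmetric] using W W' M n by (intro col_mult2[of _ n n _ n]) auto
    also have "\<dots> = ?W' *\<^sub>v (e \<cdot>\<^sub>v v)"
      using assoc_mult_mat_vec[OF W' M v] Mv by simp
    also have "\<dots> = e \<cdot>\<^sub>v (?W' *\<^sub>v col W 0)"
      unfolding W(3) by (rule mult_mat_vec[OF W' v])
    also have "?W' *\<^sub>v col W 0 = col (?W' * W) 0"
      using W W' n by (intro col_mult2[symmetric, of _ n n _ n]) auto
    finally have "col A 0 $ i = (e \<cdot>\<^sub>v col (1\<^sub>m n) 0) $ i" by (simp only: W'W)
    then show ?thesis using A i n by (simp)
  qed
  have Aij: "A $$ (j, i) = A $$ (i, j)" if "i < n" "j < n" for i j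
    using A_sym A that by (metis carrier_matD index_transpose_mat(1))
  define N where "N = mat n1 n1 (\<lambda>(i, j). A $$ (Suc i, Suc j))"
  have N: "N \<in> carrier_mat n1 n1" by (simp add: N_def)
  have N_sym: "transpose_mat N = N"
    using n by (intro eq_matI) (auto simp: N_def Aij)
  define E where "E = mat 1 1 (\<lambda>_. e)"
  have E: "E \<in> carrier_mat 1 1" by (simp add: E_def)
  have A_block: "A = four_block_mat E (0\<^sub>m 1 n1) (0\<^sub>m n1 1) N"
  proof (rule eq_matI)
    fix i j
    assume "i < dim_row (four_block_mat E (0\<^sub>m 1 n1) (0\<^sub>m n1 1) N)"
      and "j < dim_col (four_block_mat E (0\<^sub>m 1 n1) (0\<^sub>m n1 1) N)"
    then have ij: "i < n" "j < n" using n N E by auto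
    then show "A $$ (i, j) = four_block_mat E (0\<^sub>m 1 n1) (0\<^sub>m n1 1) N $$ (i, j)"
      using n col0[of i] col0[of j] Aij[of 0 j]
      by (cases i; cases j) (auto simp: E_def N_def)
  qed (use A N E n in auto)
  have "similar_mat A M"
    unfolding similar_mat_def
    by (intro exI[of _ ?W'] exI[of _ W] similar_mat_witI[of _ _ n])
       (use W W' W'W WW' M A in \<open>auto simp: A_def\<close>)
  then have "char_poly A = [:-e, 1:] * (\<Prod>e\<leftarrow>es. [:-e, 1:])"
    using Cons.prems(3) by (simp add: char_poly_similar)
  moreover have "char_poly A = char_poly E * char_poly N"
    unfolding A_block by (rule char_poly_four_block_zeros_col[OF E _ N]) simp
  moreover have "char_poly E = [:-e, 1:]"
    by (simp add: E_def char_poly_defs det_def sign_def)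
  ultimately have "char_poly N = (\<Prod>e\<leftarrow>es. [:-e, 1:])"
    by (metis mult_cancel_left pCons_eq_0_iff zero_neq_one)
  from Cons.IH[OF N N_sym this] obtain R where R: "R \<in> carrier_mat n1 n1"
    and R_on: "orthonormal_columns R" and RNR: "transpose_mat R * N * R = mat_diag n1 (\<lambda>i. es ! i)"
    by blast
  have RR: "transpose_mat R * R = 1\<^sub>m n1" using R R_on by (simp add: orthonormal_columns_def)
  define F where "F = four_block_mat (1\<^sub>m 1) (0\<^sub>m 1 n1) (0\<^sub>m n1 1) R"
  have F: "F \<in> carrier_mat n n"
    unfolding F_def n using four_block_carrier_mat[OF one_carrier_mat R, of 1] by simp
  have F': "transpose_mat F = four_block_mat (1\<^sub>m 1) (0\<^sub>m 1 n1) (0\<^sub>m n1 1) (transpose_mat R)"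
    unfolding F_def using R by (subst transpose_four_block_mat[of _ 1 1 _ n1 _ n1]) auto
  have FF: "transpose_mat F * F = 1\<^sub>m n"
    unfolding F' unfolding F_def using R RR n
    by (subst mult_four_block_mat[of _ 1 1 _ n1 _ n1 _ _ 1 _ n1]) auto
  have "transpose_mat F * A * F = four_block_mat E (0\<^sub>m 1 n1) (0\<^sub>m n1 1) (transpose_mat R * N * R)"
    unfolding F' unfolding F_def A_block using R N E
    by (subst mult_four_block_mat[of _ 1 1 _ n1 _ n1 _ _ 1 _ n1], simp_all)
       (subst mult_four_block_mat[of _ 1 1 _ n1 _ n1 _ _ 1 _ n1], simp_all)
  also have "\<dots> = mat_diag n (\<lambda>i. (e # es) ! i)"
    unfolding RNR using n
    by (intro eq_matI) (auto simp: mat_diag_def E_def nth_Cons')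
  finally have FAF: "transpose_mat F * A * F = mat_diag n (\<lambda>i. (e # es) ! i)" .
  define Q where "Q = W * F"
  have Q: "Q \<in> carrier_mat n n" using W F by (simp add: Q_def)
  have Q': "transpose_mat Q = transpose_mat F * ?W'"
    unfolding Q_def using transpose_mult[OF W(1) F] .
  have F'c: "transpose_mat F \<in> carrier_mat n n" using F by simp
  have "transpose_mat Q * Q = transpose_mat F * (?W' * W) * F"
    unfolding Q' unfolding Q_def using W W' F F'c by (simp add: assoc_mult_mat[of _ n n _ n _ n])
  then have "orthonormal_columns Q"
    using F F'c FF Q by (simp add: W'W orthonormal_columns_def)
  moreover have "transpose_mat Q * M * Q = transpose_mat F * A * F"
    unfolding Q' unfolding Q_def A_def using W W' F F'c M
    by (simp add: assoc_mult_mat[of _ n n _ n _ n])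
  ultimately show ?case using Q FAF by auto
qed

section \<open>Interlacing of eigenvalues under compression\<close>

text \<open>
  A homogeneous linear system with fewer equations (indexed by \<open>J\<close>) than unknowns (indexed by \<open>I\<close>)
  has a nontrivial solution; the induction eliminates one unknown with one equation.
\<close>
lemma nontrivial_kernel:
  fixes Z :: "'b \<Rightarrow> 'a \<Rightarrow> real"
  assumes "finite J" "finite I" "card J < card I"
  shows "\<exists>c. (\<exists>i\<in>I. c i \<noteq> 0) \<and> (\<forall>j\<in>J. (\<Sum>i\<in>I. Z j i * c i) = 0)"
  using assms
proof (induction J arbitrary: I Z rule: finite_induct)
  case empty
  then have "I \<noteq> {}" by auto
  then show ?case by (intro exI[of _ "\<lambda>_. 1"]) auto
next
  case (insert j0 J)
  show ?case
  proof (cases "\<forall>i\<in>I. Z j0 i = 0")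
    case True
    have "card J < card I" using insert.prems insert.hyps by simp
    from insert.IH[OF insert.prems(1) this, of Z] True show ?thesis by auto
  next
    case False
    then obtain i0 where i0: "i0 \<in> I" "Z j0 i0 \<noteq> 0" by blast
    define I' where "I' = I - {i0}"
    define Z' where "Z' j i = Z j i - Z j i0 * Z j0 i / Z j0 i0" for j i
    have fin: "finite I'" and card: "card J < card I'"
      using insert.prems insert.hyps i0 by (auto simp: I'_def)
    obtain c where c: "\<exists>i\<in>I'. c i \<noteq> 0" "\<forall>j\<in>J. (\<Sum>i\<in>I'. Z' j i * c i) = 0"
      using insert.IH[OF fin card, of Z'] by blast
    define t where "t = (\<Sum>i\<in>I'. Z j0 i * c i)"
    define c' where "c' = c(i0 := - t / Z j0 i0)"
    have sum_c': "(\<Sum>i\<in>I. Z j i * c' i) = Z j i0 * (- t / Z j0 i0) + (\<Sum>i\<in>I'. Z j i * c i)" for j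
    proof -
      have "(\<Sum>i\<in>I. Z j i * c' i) = Z j i0 * c' i0 + (\<Sum>i\<in>I'. Z j i * c' i)"
        unfolding I'_def by (rule sum.remove) (use insert.prems i0 in auto)
      also have "(\<Sum>i\<in>I'. Z j i * c' i) = (\<Sum>i\<in>I'. Z j i * c i)"
        by (intro sum.cong) (auto simp: I'_def c'_def)
      finally show ?thesis by (simp add: c'_def)
    qed
    have "(\<Sum>i\<in>I. Z j i * c' i) = 0" if "j \<in> insert j0 J" for j
    proof (cases "j = j0")
      case True
      then show ?thesis using i0 by (simp add: sum_c' t_def)
    next
      case False
      then have "0 = (\<Sum>i\<in>I'. Z' j i * c i)" using c(2) that by simp
      also have "\<dots> = (\<Sum>i\<in>I'. Z j i * c i - (Z j i0 / Z j0 i0) * (Z j0 i * c i))"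
        unfolding Z'_def by (intro sum.cong) (auto simp: field_simps)
      also have "\<dots> = (\<Sum>i\<in>I. Z j i * c' i)"
        by (simp only: sum_c' t_def sum_subtractf sum_distrib_left[symmetric]) simp
      finally show ?thesis by simp
    qed
    moreover have "\<exists>i\<in>I. c' i \<noteq> 0" using c(1) by (auto simp: I'_def c'_def)
    ultimately show ?thesis by blast
  qed
qed

text \<open>
  The comparison step of the Courant--Fischer argument. Let \<open>Z\<close> be an isometry that carries the
  form with weights \<open>e\<close> to the form with weights \<open>d\<close>. A nonzero \<open>c\<close> supported on \<open>I\<close> whose
  image \<open>z = Z c\<close> vanishes on \<open>J\<close> exists because \<open>J\<close> is smaller than \<open>I\<close>; if all weights
  \<open>e\<close> on \<open>I\<close> exceeded all weights \<open>d\<close> off \<open>J\<close>, the two forms could not agree at \<open>c\<close>.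
\<close>
lemma rayleigh_index:
  fixes Z :: "real mat"
  assumes Z: "Z \<in> carrier_mat m l"
    and iso: "\<And>c. c \<in> carrier_vec l \<Longrightarrow> (\<Sum>j<m. ((Z *\<^sub>v c) $ j)\<^sup>2) = (\<Sum>i<l. (c $ i)\<^sup>2)"
    and form: "\<And>c. c \<in> carrier_vec l \<Longrightarrow>
      (\<Sum>j<m. d j * ((Z *\<^sub>v c) $ j)\<^sup>2) = (\<Sum>i<l. e i * (c $ i)\<^sup>2)"
    and I: "I \<subseteq> {..<l}" and J: "J \<subseteq> {..<m}" and card: "card J < card I"
  shows "\<exists>i\<in>I. \<exists>j\<in>{..<m} - J. e i \<le> d j"
proof (rule ccontr)
  assume "\<not> ?thesis"
  then have less: "d j < e i" if "i \<in> I" "j < m" "j \<notin> J" for i j using that by force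
  have fin: "finite I" "finite J" using I J finite_subset by auto
  obtain c0 where c0: "\<exists>i\<in>I. c0 i \<noteq> 0" "\<forall>j\<in>J. (\<Sum>i\<in>I. Z $$ (j, i) * c0 i) = 0"
    using nontrivial_kernel[OF fin(2,1) card, of "\<lambda>j i. Z $$ (j, i)"] by blast
  define c where "c = vec l (\<lambda>i. if i \<in> I then c0 i else 0)"
  define z where "z = Z *\<^sub>v c"
  have c: "c \<in> carrier_vec l" by (simp add: c_def)
  have c_supp: "c $ i = 0" if "i < l" "i \<notin> I" for i using that by (simp add: c_def)
  have z_supp: "z $ j = 0" if "j \<in> J" for j
  proof -
    have "z $ j = (\<Sum>i<l. Z $$ (j, i) * c $ i)"
      using that J Z c by (auto simp: z_def scalar_prod_def atLeast0LessThan)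
    also have "\<dots> = (\<Sum>i\<in>I. Z $$ (j, i) * c0 i)"
      using I by (intro sum.mono_neutral_cong_right) (auto simp: c_def)
    finally show ?thesis using c0(2) that by simp
  qed
  obtain i0 where i0: "i0 \<in> I" "c $ i0 \<noteq> 0" using c0(1) I by (auto simp: c_def)
  have "0 < (\<Sum>i<l. (c $ i)\<^sup>2)"
    using i0 I by (intro sum_pos2[of _ i0]) auto
  then have "(\<Sum>j<m. (z $ j)\<^sup>2) \<noteq> 0" using iso[OF c] by (simp add: z_def)
  then have "\<exists>j\<in>{..<m}. (z $ j)\<^sup>2 \<noteq> 0" by (rule contrapos_np) simp
  then obtain j0 where j0: "j0 < m" "z $ j0 \<noteq> 0" by auto
  \<comment> \<open>All terms of this double sum are nonnegative and one is positive, but the sum equals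
    \<open>(\<Sum> e c\<^sup>2) |z|\<^sup>2 - |c|\<^sup>2 (\<Sum> d z\<^sup>2) = 0\<close>.\<close>
  have "0 < (\<Sum>i<l. \<Sum>j<m. (e i - d j) * ((c $ i)\<^sup>2 * (z $ j)\<^sup>2))"
  proof -
    have nonneg: "0 \<le> (e i - d j) * ((c $ i)\<^sup>2 * (z $ j)\<^sup>2)" if "i < l" "j < m" for i j
      using less[of i j] c_supp[of i] z_supp[of j] that
      by (cases "i \<in> I \<and> j \<notin> J") auto
    have "0 < (e i0 - d j0) * ((c $ i0)\<^sup>2 * (z $ j0)\<^sup>2)"
      using i0 j0 z_supp[of j0] less[of i0 j0] by (intro mult_pos_pos) auto
    then have "0 < (\<Sum>j<m. (e i0 - d j) * ((c $ i0)\<^sup>2 * (z $ j)\<^sup>2))"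
      using j0 i0 I nonneg by (intro sum_pos2[where i = j0]) auto
    then show ?thesis
      using i0 I nonneg by (intro sum_pos2[where i = i0 and I = "{..<l}"]) (auto intro: sum_nonneg)
  qed
  also have "(\<Sum>i<l. \<Sum>j<m. (e i - d j) * ((c $ i)\<^sup>2 * (z $ j)\<^sup>2))
      = (\<Sum>i<l. e i * (c $ i)\<^sup>2) * (\<Sum>j<m. (z $ j)\<^sup>2) - (\<Sum>i<l. (c $ i)\<^sup>2) * (\<Sum>j<m. d j * (z $ j)\<^sup>2)"
    unfolding sum_product sum_subtractf[symmetric]
    by (intro sum.cong refl) (simp add: algebra_simps)
  also have "\<dots> = 0" using iso[OF c] form[OF c] by (simp add: z_def)
  finally show False by simp
qed

lemma index_mat_diag_mult_vec:
  fixes y :: "real vec"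
  assumes y: "y \<in> carrier_vec n" and i: "i < n"
  shows "(mat_diag n d *\<^sub>v y) $ i = d i * y $ i"
proof -
  have "(mat_diag n d *\<^sub>v y) $ i = (\<Sum>k<n. (if i = k then d k else 0) * y $ k)"
    using i y by (simp add: mat_diag_def scalar_prod_def atLeast0LessThan)
  also have "\<dots> = (\<Sum>k<n. if k = i then d i * y $ i else 0)"
    by (intro sum.cong) auto
  finally show ?thesis using i by simp
qed

text \<open>In the coordinates \<open>Q\<^sup>T x\<close> the quadratic form of \<open>M\<close> is a weighted sum of squares.\<close>
lemma orthogonal_diag_form:
  fixes M Q :: "real mat"
  assumes M: "M \<in> carrier_mat n n" and Q: "Q \<in> carrier_mat n n" "orthonormal_columns Q"
    and diag: "transpose_mat Q * M * Q = mat_diag n d" and x: "x \<in> carrier_vec n"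
  shows "x \<bullet> (M *\<^sub>v x) = (\<Sum>i<n. d i * ((transpose_mat Q *\<^sub>v x) $ i)\<^sup>2)"
    and "x \<bullet> x = (\<Sum>i<n. ((transpose_mat Q *\<^sub>v x) $ i)\<^sup>2)"
proof -
  define y where "y = transpose_mat Q *\<^sub>v x"
  have Q': "transpose_mat Q \<in> carrier_mat n n" using Q by simp
  have y: "y \<in> carrier_vec n" using Q' x by (simp add: y_def)
  have "Q * transpose_mat Q = 1\<^sub>m n"
    using mat_mult_left_right_inverse[OF Q' Q(1)] Q by (simp add: orthonormal_columns_def)
  then have x_y: "x = Q *\<^sub>v y"
    using assoc_mult_mat_vec[OF Q(1) Q' x] x by (simp add: y_def)
  have "x \<bullet> (M *\<^sub>v x) = (Q *\<^sub>v y) \<bullet> (M *\<^sub>v (Q *\<^sub>v y))" by (simp only: x_y[symmetric])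
  also have "\<dots> = (M *\<^sub>v (Q *\<^sub>v y)) \<bullet> (Q *\<^sub>v y)"
    using M Q y by (intro comm_scalar_prod[of _ n]) auto
  also have "\<dots> = (transpose_mat Q *\<^sub>v (M *\<^sub>v (Q *\<^sub>v y))) \<bullet> y"
    using transpose_vec_mult_scalar[OF Q(1) y, of "M *\<^sub>v (Q *\<^sub>v y)"] M Q y by simp
  also have "transpose_mat Q *\<^sub>v (M *\<^sub>v (Q *\<^sub>v y)) = mat_diag n d *\<^sub>v y"
  proof -
    have "mat_diag n d *\<^sub>v y = (transpose_mat Q * M) *\<^sub>v (Q *\<^sub>v y)"
      unfolding diag[symmetric] using M Q Q' y by (intro assoc_mult_mat_vec[of _ n n]) auto
    also have "\<dots> = transpose_mat Q *\<^sub>v (M *\<^sub>v (Q *\<^sub>v y))"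
      using M Q Q' y by (intro assoc_mult_mat_vec[of _ n n _ n]) auto
    finally show ?thesis by simp
  qed
  also have "\<dots> \<bullet> y = (\<Sum>i<n. d i * (y $ i)\<^sup>2)"
  proof -
    have "(mat_diag n d *\<^sub>v y) $ i = d i * y $ i" if "i < n" for i
      using that by (rule index_mat_diag_mult_vec[OF y])
    then show ?thesis
      using y by (simp add: scalar_prod_def atLeast0LessThan power2_eq_square mult.assoc del: index_mult_mat_vec)
  qed
  finally show "x \<bullet> (M *\<^sub>v x) = (\<Sum>i<n. d i * ((transpose_mat Q *\<^sub>v x) $ i)\<^sup>2)"
    by (simp only: y_def)
  have "x \<bullet> x = y \<bullet> y"
    unfolding x_y by (rule orthonormal_columns_scalar_prod[OF Q y y])
  then show "x \<bullet> x = (\<Sum>i<n. ((transpose_mat Q *\<^sub>v x) $ i)\<^sup>2)"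
    using scalar_prod_self_sum[OF y] by (simp only: y_def)
qed

text \<open>
  Cauchy's interlacing theorem for the compression \<open>P\<^sup>T M P\<close>, with zero-based indices and both
  spectra listed in decreasing order by given orthogonal diagonalizations.
\<close>
lemma compression_interlacing:
  fixes M P Q W :: "real mat" and d e :: "nat \<Rightarrow> real"
  assumes M: "M \<in> carrier_mat m m"
    and P: "P \<in> carrier_mat m l" "orthonormal_columns P"
    and Q: "Q \<in> carrier_mat m m" "orthonormal_columns Q" "transpose_mat Q * M * Q = mat_diag m d"
    and W: "W \<in> carrier_mat l l" "orthonormal_columns W"
      "transpose_mat W * (transpose_mat P * M * P) * W = mat_diag l e"
    and d: "\<And>i j. i \<le> j \<Longrightarrow> j < m \<Longrightarrow> d j \<le> d i"
    and e: "\<And>i j. i \<le> j \<Longrightarrow> j < l \<Longrightarrow> e j \<le> e i"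
    and "l \<le> m" "i < l"
  shows "e i \<le> d i" and "d (i + (m - l)) \<le> e i"
proof -
  define N where "N = transpose_mat P * M * P"
  have N: "N \<in> carrier_mat l l" using M P by (simp add: N_def)
  define Z where "Z = transpose_mat Q * (P * W)"
  have Z: "Z \<in> carrier_mat m l" using P Q W by (simp add: Z_def)
  have W': "transpose_mat W \<in> carrier_mat l l" using W by simp
  have W'W: "transpose_mat W * W = 1\<^sub>m l" using W by (simp add: orthonormal_columns_def)
  have forms: "(\<Sum>j<m. ((Z *\<^sub>v c) $ j)\<^sup>2) = (\<Sum>i<l. (c $ i)\<^sup>2)"
    "(\<Sum>j<m. d j * ((Z *\<^sub>v c) $ j)\<^sup>2) = (\<Sum>i<l. e i * (c $ i)\<^sup>2)" if c: "c \<in> carrier_vec l" for c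
  proof -
    define y where "y = W *\<^sub>v c"
    define x where "x = P *\<^sub>v y"
    have y: "y \<in> carrier_vec l" and x: "x \<in> carrier_vec m"
      using W P c by (auto simp: y_def x_def)
    have "x = (P * W) *\<^sub>v c"
      using assoc_mult_mat_vec[OF P(1) W(1) c] by (simp add: x_def y_def)
    then have Zc: "Z *\<^sub>v c = transpose_mat Q *\<^sub>v x"
      unfolding Z_def using P Q W c by (simp add: assoc_mult_mat_vec[of _ m m _ l])
    have c_y: "c = transpose_mat W *\<^sub>v y"
      using assoc_mult_mat_vec[OF W' W(1) c] c by (simp add: y_def W'W)
    have "x \<bullet> x = y \<bullet> y" unfolding x_def by (rule orthonormal_columns_scalar_prod[OF P y y])
    then show "(\<Sum>j<m. ((Z *\<^sub>v c) $ j)\<^sup>2) = (\<Sum>i<l. (c $ i)\<^sup>2)"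
      unfolding Zc using orthogonal_diag_form(2)[OF M Q x] orthogonal_diag_form(2)[OF N W(1,2) _ y, of e] W(3)
      by (simp add: c_y[symmetric] N_def)
    have "y \<bullet> (N *\<^sub>v y) = y \<bullet> (transpose_mat P *\<^sub>v (M *\<^sub>v x))"
    proof -
      have "N *\<^sub>v y = (transpose_mat P * M) *\<^sub>v x"
        unfolding N_def x_def using M P y by (intro assoc_mult_mat_vec[of _ l m]) auto
      also have "\<dots> = transpose_mat P *\<^sub>v (M *\<^sub>v x)"
        using M P x by (intro assoc_mult_mat_vec[of _ l m _ m]) auto
      finally show ?thesis by simp
    qed
    also have "\<dots> = (transpose_mat P *\<^sub>v (M *\<^sub>v x)) \<bullet> y"
      using M P x y by (intro comm_scalar_prod[of _ l]) auto
    also have "\<dots> = (M *\<^sub>v x) \<bullet> x"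
      using transpose_vec_mult_scalar[OF P(1) y, of "M *\<^sub>v x"] M x by (simp add: x_def)
    also have "\<dots> = x \<bullet> (M *\<^sub>v x)"
      using M x by (intro comm_scalar_prod[of _ m]) auto
    finally show "(\<Sum>j<m. d j * ((Z *\<^sub>v c) $ j)\<^sup>2) = (\<Sum>i<l. e i * (c $ i)\<^sup>2)"
      unfolding Zc using orthogonal_diag_form(1)[OF M Q x] orthogonal_diag_form(1)[OF N W(1,2) _ y, of e] W(3)
      by (simp add: c_y[symmetric] N_def)
  qed
  \<comment> \<open>The first \<open>i + 1\<close> eigenvectors of the compression against all but the first \<open>i\<close> of \<open>M\<close>.\<close>
  show "e i \<le> d i"
  proof -
    obtain i' j where "i' \<in> {..i}" "j \<in> {..<m} - {..<i}" "e i' \<le> d j"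
      using rayleigh_index[OF Z forms, of "{..i}" "{..<i}"] \<open>l \<le> m\<close> \<open>i < l\<close>
      by (auto simp: subset_iff)
    moreover from this have "e i \<le> e i'" "d j \<le> d i" using e[of i' i] d[of i j] \<open>i < l\<close> by auto
    ultimately show ?thesis by linarith
  qed
  \<comment> \<open>The last \<open>l - i\<close> eigenvectors of the compression against the first \<open>i + (m - l) + 1\<close> of
    \<open>M\<close>; negating all weights reverses the comparison.\<close>
  show "d (i + (m - l)) \<le> e i"
  proof -
    let ?J = "{i + (m - l)<..<m}"
    have neg: "(\<Sum>j<m. - d j * ((Z *\<^sub>v c) $ j)\<^sup>2) = (\<Sum>i<l. - e i * (c $ i)\<^sup>2)"
      if "c \<in> carrier_vec l" for c
      using forms(2)[OF that] by (simp add: sum_negf)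
    have sub: "{i..<l} \<subseteq> {..<l}" "?J \<subseteq> {..<m}" by auto
    have card: "card ?J < card {i..<l}" using \<open>l \<le> m\<close> \<open>i < l\<close> by simp
    obtain i' j where "i' \<in> {i..<l}" "j \<in> {..<m} - ?J" "- e i' \<le> - d j"
      using rayleigh_index[OF Z forms(1) neg sub card] by blast
    moreover from this have "e i' \<le> e i" "d (i + (m - l)) \<le> d j"
      using e[of i i'] d[of j "i + (m - l)"] \<open>l \<le> m\<close> \<open>i < l\<close> by auto
    ultimately show ?thesis by linarith
  qed
qed

section \<open>Singular values\<close>

lemma gram_eigenvalues_diagonalization:
  fixes A :: "real mat"
  assumes A: "A \<in> carrier_mat m n"
  defines "es \<equiv> gram_eigenvalues A"
  obtains Q where "Q \<in> carrier_mat m m" "orthonormal_columns Q"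
    "transpose_mat Q * (A * transpose_mat A) * Q = mat_diag m (\<lambda>i. es ! i)"
    "length es = m" "\<And>i j. i \<le> j \<Longrightarrow> j < m \<Longrightarrow> es ! j \<le> es ! i"
proof -
  define M where "M = A * transpose_mat A"
  have M: "M \<in> carrier_mat m m" and sym: "transpose_mat M = M"
    using A transpose_mult[OF A, of "transpose_mat A" m] by (auto simp: M_def)
  define R where "R = proots (char_poly M)"
  have es: "es = rev (sorted_list_of_multiset R)"
    by (simp add: es_def gram_eigenvalues_def R_def M_def)
  then have mset: "mset es = R" by simp
  then have len: "length es = m"
    using symmetric_char_poly_split(2)[OF M sym] by (metis R_def size_mset)
  have sorted: "es ! j \<le> es ! i" if "i \<le> j" "j < m" for i j
    using sorted_rev_nth_mono[of es i j] that len unfolding es by simp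
  have "(\<Prod>e\<leftarrow>es. [:-e, 1:]) = (\<Prod>x\<in>#R. [:-x, 1:])"
    unfolding mset[symmetric] by (simp add: prod_mset_prod_list flip: mset_map)
  then have "char_poly M = (\<Prod>e\<leftarrow>es. [:-e, 1:])"
    using symmetric_char_poly_split(1)[OF M sym] by (simp only: R_def)
  from symmetric_diagonalization[OF M sym this] show ?thesis
    using that len sorted unfolding M_def by blast
qed

text \<open>
  Two decreasingly ordered orthogonal diagonalizations of \<open>B B\<^sup>T\<close> have the same diagonal:
  interlacing with the trivial compression \<open>P = I\<close> gives both inequalities.
\<close>
lemma singular_value_eqI:
  fixes B :: "real mat"
  assumes B: "B \<in> carrier_mat l n"
    and U: "U \<in> carrier_mat l l" "orthonormal_columns U"
    and diag: "transpose_mat U * (B * transpose_mat B) * U = mat_diag l (\<lambda>i. (s i)\<^sup>2)"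
    and s: "\<And>i. i < l \<Longrightarrow> 0 \<le> s i" "\<And>i j. i \<le> j \<Longrightarrow> j < l \<Longrightarrow> s j \<le> s i"
    and i: "i < l"
  shows "singular_value B (i + 1) = s i"
proof -
  let ?es = "gram_eigenvalues B" and ?M = "B * transpose_mat B"
  obtain W where W: "W \<in> carrier_mat l l" "orthonormal_columns W"
      "transpose_mat W * ?M * W = mat_diag l (\<lambda>i. ?es ! i)"
    and len: "length ?es = l" and es: "\<And>i j. i \<le> j \<Longrightarrow> j < l \<Longrightarrow> ?es ! j \<le> ?es ! i"
    using gram_eigenvalues_diagonalization[OF B] by metis
  have M: "?M \<in> carrier_mat l l" using B by simp
  have one: "(1\<^sub>m l :: real mat) \<in> carrier_mat l l" "orthonormal_columns (1\<^sub>m l)"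
    by (auto simp: orthonormal_columns_def)
  have M_one: "transpose_mat (1\<^sub>m l) * ?M * 1\<^sub>m l = ?M"
    using left_mult_one_mat[OF M] right_mult_one_mat[OF M] by simp
  have s2: "(s j)\<^sup>2 \<le> (s i)\<^sup>2" if "i \<le> j" "j < l" for i j
    using s that by (intro power_mono) auto
  have "?es ! i \<le> (s i)\<^sup>2"
    by (rule compression_interlacing(1)[OF M one U diag W(1,2) _ s2 es _ i])
      (use W(3) in \<open>simp_all only: M_one order_refl\<close>)
  moreover have "(s i)\<^sup>2 \<le> ?es ! i"
    by (rule compression_interlacing(1)[OF M one W U(1,2) _ es s2 _ i])
      (use diag in \<open>simp_all only: M_one order_refl\<close>)
  ultimately have "?es ! i = (s i)\<^sup>2" by simp
  then show ?thesis using i len s(1) by (simp add: singular_value_def)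
qed

text \<open>The argument of \<open>singular_value\<close> is one-based, hence the shift by one from the index \<open>i\<close>.\<close>
lemma singular_value_compression:
  fixes A P :: "real mat"
  assumes A: "A \<in> carrier_mat m n" and P: "P \<in> carrier_mat m l" "orthonormal_columns P"
    and "l \<le> m" and i: "i < l"
  shows "singular_value (transpose_mat P * A) (i + 1) \<le> singular_value A (i + 1)"
    and "singular_value A (i + (m - l) + 1) \<le> singular_value (transpose_mat P * A) (i + 1)"
proof -
  let ?B = "transpose_mat P * A"
  let ?d = "\<lambda>i. gram_eigenvalues A ! i" and ?e = "\<lambda>i. gram_eigenvalues ?B ! i"
  have P': "transpose_mat P \<in> carrier_mat l m" and A': "transpose_mat A \<in> carrier_mat n m"
    using P A by auto
  have B: "?B \<in> carrier_mat l n" using P A by simp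
  obtain Q where Q: "Q \<in> carrier_mat m m" "orthonormal_columns Q"
      "transpose_mat Q * (A * transpose_mat A) * Q = mat_diag m ?d"
    and lenA: "length (gram_eigenvalues A) = m" and d: "\<And>i j. i \<le> j \<Longrightarrow> j < m \<Longrightarrow> ?d j \<le> ?d i"
    using gram_eigenvalues_diagonalization[OF A] by metis
  obtain W where W: "W \<in> carrier_mat l l" "orthonormal_columns W"
      "transpose_mat W * (?B * transpose_mat ?B) * W = mat_diag l ?e"
    and lenB: "length (gram_eigenvalues ?B) = l" and e: "\<And>i j. i \<le> j \<Longrightarrow> j < l \<Longrightarrow> ?e j \<le> ?e i"
    using gram_eigenvalues_diagonalization[OF B] by metis
  have M: "A * transpose_mat A \<in> carrier_mat m m" using A by simp
  have "transpose_mat ?B = transpose_mat A * P"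
    using transpose_mult[OF P' A] by simp
  then have "?B * transpose_mat ?B = transpose_mat P * A * (transpose_mat A * P)" by simp
  also have "\<dots> = transpose_mat P * (A * (transpose_mat A * P))"
    using P P' A A' by (intro assoc_mult_mat[of _ l m _ n _ l]) auto
  also have "A * (transpose_mat A * P) = A * transpose_mat A * P"
    using P P' A A' by (intro assoc_mult_mat[symmetric, of _ m n _ m _ l]) auto
  also have "transpose_mat P * (A * transpose_mat A * P) = transpose_mat P * (A * transpose_mat A) * P"
    using P P' M by (intro assoc_mult_mat[symmetric, of _ l m _ m _ l]) auto
  finally have "transpose_mat W * (transpose_mat P * (A * transpose_mat A) * P) * W = mat_diag l ?e"
    using W(3) by simp
  note interlacing = compression_interlacing[OF M P Q W(1,2) this d e \<open>l \<le> m\<close> i]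
  show "singular_value ?B (i + 1) \<le> singular_value A (i + 1)"
    using interlacing(1) lenA lenB i \<open>l \<le> m\<close> by (simp add: singular_value_def)
  show "singular_value A (i + (m - l) + 1) \<le> singular_value ?B (i + 1)"
    using interlacing(2) lenA lenB i \<open>l \<le> m\<close> by (simp add: singular_value_def)
qed

lemma compact_svd_gram:
  fixes B U S V :: "real mat"
  assumes B: "B \<in> carrier_mat l n" and "l \<le> n" and svd: "compact_svd B U S V"
  shows "transpose_mat U * (B * transpose_mat B) * U = mat_diag l (\<lambda>i. (S $$ (i, i))\<^sup>2)"
proof -
  have U: "U \<in> carrier_mat l l" and V: "V \<in> carrier_mat n l" and S: "S \<in> carrier_mat l l"
    and UU: "transpose_mat U * U = 1\<^sub>m l" and VV: "transpose_mat V * V = 1\<^sub>m l"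
    and S_diag: "diagonal_mat S" and B_eq: "B = U * S * transpose_mat V"
    using B \<open>l \<le> n\<close> svd by (auto simp: compact_svd_def Let_def min_def orthonormal_columns_def)
  have U': "transpose_mat U \<in> carrier_mat l l" and V': "transpose_mat V \<in> carrier_mat l n"
    using U V by auto
  have S': "transpose_mat S = S"
    using S S_diag by (intro eq_matI) (auto simp: diagonal_mat_def, metis)
  have US: "U * S \<in> carrier_mat l l" using U S by simp
  have BV: "transpose_mat U * B = S * transpose_mat V"
  proof -
    have "transpose_mat U * B = transpose_mat U * (U * S) * transpose_mat V"
      unfolding B_eq using assoc_mult_mat[OF U' US V'] by simp
    also have "transpose_mat U * (U * S) = S"
      using assoc_mult_mat[OF U' U S] UU S by simp
    finally show ?thesis .
  qed
  have B': "transpose_mat B \<in> carrier_mat n l" using B by simp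
  have "transpose_mat (S * transpose_mat V) = V * S"
    using transpose_mult[OF S V'] S' by simp
  moreover have "transpose_mat (transpose_mat U * B) = transpose_mat B * U"
    using transpose_mult[OF U' B] by simp
  ultimately have B'U: "transpose_mat B * U = V * S" using BV by simp
  have "transpose_mat U * (B * transpose_mat B) * U = transpose_mat U * B * (transpose_mat B * U)"
  proof -
    have "transpose_mat U * (B * transpose_mat B) * U = transpose_mat U * B * transpose_mat B * U"
      using assoc_mult_mat[OF U' B B'] by simp
    also have "\<dots> = transpose_mat U * B * (transpose_mat B * U)"
      using U' B B' U by (intro assoc_mult_mat[of _ l n _ l _ l]) auto
    finally show ?thesis .
  qed
  also have "\<dots> = S * transpose_mat V * (V * S)" by (simp only: BV B'U)
  also have "\<dots> = S * (transpose_mat V * (V * S))"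
    using S V V' by (intro assoc_mult_mat[of _ l l _ n _ l]) auto
  also have "transpose_mat V * (V * S) = S"
    using assoc_mult_mat[OF V' V S] VV S by simp
  also have "S * S = mat_diag l (\<lambda>i. (S $$ (i, i))\<^sup>2)"
  proof -
    have eq: "S = mat_diag l (\<lambda>i. S $$ (i, i))"
      using S S_diag by (intro eq_matI) (auto simp: mat_diag_def diagonal_mat_def)
    have "S * S = mat_diag l (\<lambda>i. S $$ (i, i)) * mat_diag l (\<lambda>i. S $$ (i, i))"
      using eq by simp
    then show ?thesis by (simp add: power2_eq_square)
  qed
  finally show ?thesis .
qed

section \<open>The error of the truncated approximation\<close>

lemma norm_mat_diag_mult_le:
  assumes x: "x \<in> carrier_vec n" and t: "\<And>i. i < n \<Longrightarrow> \<bar>t i\<bar> \<le> c" and "0 \<le> c"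
  shows "euclidean_norm (mat_diag n t *\<^sub>v x) \<le> c * euclidean_norm x"
proof -
  note Tx = index_mat_diag_mult_vec[OF x, of _ t]
  have "euclidean_norm (mat_diag n t *\<^sub>v x) = L2_set (\<lambda>i. \<bar>t i * x $ i\<bar>) {0..<n}"
    using Tx by (auto simp: euclidean_norm_L2_set L2_set_def mat_diag_def
        simp del: index_mult_mat_vec intro!: sum.cong)
  also have "\<dots> \<le> L2_set (\<lambda>i. c * \<bar>x $ i\<bar>) {0..<n}"
    using t by (intro L2_set_mono) (auto simp: abs_mult intro: mult_right_mono)
  also have "\<dots> = c * L2_set (\<lambda>i. \<bar>x $ i\<bar>) {0..<n}"
    using \<open>0 \<le> c\<close> by (simp add: L2_set_right_distrib)
  also have "L2_set (\<lambda>i. \<bar>x $ i\<bar>) {0..<n} = euclidean_norm x"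
    using x by (simp add: euclidean_norm_L2_set L2_set_def)
  finally show ?thesis .
qed

lemma truncated_svd:
  fixes U S V :: "real mat"
  assumes U: "U \<in> carrier_mat l r" and V: "V \<in> carrier_mat n r"
    and S: "S \<in> carrier_mat r r" "diagonal_mat S" and "k \<le> r"
  shows "U * S * transpose_mat V - first_columns k U * leading_block k S * transpose_mat (first_columns k V)
    = U * mat_diag r (\<lambda>i. if i < k then 0 else S $$ (i, i)) * transpose_mat V"
    (is "?B - ?Bk = ?T")
proof (rule eq_matI)
  fix i j
  assume "i < dim_row ?T" "j < dim_col ?T"
  then have ij: "i < l" "j < n" using U V by auto
  have S_diag: "S = mat_diag r (\<lambda>i. S $$ (i, i))"
    using S by (intro eq_matI) (auto simp: mat_diag_def diagonal_mat_def)
  have entry: "(U * mat_diag r f * transpose_mat V) $$ (i, j) = (\<Sum>a<r. U $$ (i, a) * f a * V $$ (j, a))" for f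
    using U V ij by (simp add: mat_diag_mult_right[OF U] scalar_prod_def atLeast0LessThan)
  have B: "?B $$ (i, j) = (\<Sum>a<r. U $$ (i, a) * S $$ (a, a) * V $$ (j, a))"
    by (subst S_diag) (rule entry)
  have Uk: "first_columns k U \<in> carrier_mat l k" using U by (simp add: first_columns_def)
  have "leading_block k S = mat_diag k (\<lambda>i. S $$ (i, i))"
    using S \<open>k \<le> r\<close> by (intro eq_matI) (auto simp: mat_diag_def diagonal_mat_def leading_block_def)
  then have "first_columns k U * leading_block k S = mat l k (\<lambda>(i, a). first_columns k U $$ (i, a) * S $$ (a, a))"
    using mat_diag_mult_right[OF Uk] by simp
  then have "?Bk $$ (i, j) = (\<Sum>a<k. U $$ (i, a) * S $$ (a, a) * V $$ (j, a))"
    using U V ij by (simp add: first_columns_def scalar_prod_def atLeast0LessThan)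
  also have "\<dots> = (\<Sum>a<r. if a < k then U $$ (i, a) * S $$ (a, a) * V $$ (j, a) else 0)"
    using \<open>k \<le> r\<close> by (intro sum.mono_neutral_cong_left) auto
  finally have "?B $$ (i, j) - ?Bk $$ (i, j) = ?T $$ (i, j)"
    unfolding B entry by (simp add: sum_subtractf[symmetric]) (intro sum.cong, auto)
  then show "(?B - ?Bk) $$ (i, j) = ?T $$ (i, j)"
    using U V ij by (simp add: first_columns_def)
qed (use U V in \<open>auto simp: first_columns_def\<close>)

lemma projection_error_le:
  fixes A P C :: "real mat"
  assumes A: "A \<in> carrier_mat m n" and P: "P \<in> carrier_mat m l" "orthonormal_columns P"
    and C: "C \<in> carrier_mat l n"
    and c: "\<And>x. x \<in> carrier_vec n \<Longrightarrow> euclidean_norm x \<le> 1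
      \<Longrightarrow> euclidean_norm ((transpose_mat P * A - C) *\<^sub>v x) \<le> c"
  shows "matrix_2_norm (A - P * C) \<le> c + matrix_2_norm ((1\<^sub>m m - P * transpose_mat P) * A)"
proof (rule matrix_2_norm_le)
  fix x assume "x \<in> carrier_vec (dim_col (A - P * C))" and x1: "euclidean_norm x \<le> 1"
  then have x: "x \<in> carrier_vec n" using C by simp
  let ?D = "transpose_mat P * A - C" and ?E = "(1\<^sub>m m - P * transpose_mat P) * A"
  have P': "transpose_mat P \<in> carrier_mat l m" using P by simp
  have PP: "P * transpose_mat P \<in> carrier_mat m m" using P P' by simp
  have PA: "transpose_mat P * A \<in> carrier_mat l n" using P' A by simp
  have D: "?D \<in> carrier_mat l n" by (rule minus_carrier_mat[OF C])
  have E: "?E \<in> carrier_mat m n" by (rule mult_carrier_mat[OF minus_carrier_mat[OF PP] A])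
  have "P * ?D = P * (transpose_mat P * A) - P * C"
    by (rule mult_minus_distrib_mat[OF P(1) PA C])
  moreover have "?E = A - P * (transpose_mat P * A)"
    using minus_mult_distrib_mat[OF one_carrier_mat PP A] assoc_mult_mat[OF P(1) P' A] A by simp
  ultimately have "A - P * C = P * ?D + ?E"
    using A P C by (intro eq_matI) auto
  then have "(A - P * C) *\<^sub>v x = P *\<^sub>v (?D *\<^sub>v x) + ?E *\<^sub>v x"
    using add_mult_distrib_mat_vec[of "P * ?D" m n ?E x] assoc_mult_mat_vec[OF P(1) D x] P D E x
    by simp
  then have "euclidean_norm ((A - P * C) *\<^sub>v x)
      \<le> euclidean_norm (P *\<^sub>v (?D *\<^sub>v x)) + euclidean_norm (?E *\<^sub>v x)"
    using euclidean_norm_add_le[of "P *\<^sub>v (?D *\<^sub>v x)" m "?E *\<^sub>v x"] P D E x by auto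
  also have "euclidean_norm (P *\<^sub>v (?D *\<^sub>v x)) = euclidean_norm (?D *\<^sub>v x)"
    using D x by (intro orthonormal_columns_norm[OF P]) auto
  also have "\<dots> \<le> c" by (rule c[OF x x1])
  also have "euclidean_norm (?E *\<^sub>v x) \<le> matrix_2_norm ?E"
    using x x1 E by (intro norm_le_matrix_2_norm) auto
  finally show "euclidean_norm ((A - P * C) *\<^sub>v x) \<le> c + matrix_2_norm ?E" by simp
qed

theorem theorem5p1:
  fixes A P B Ak :: "real mat" and m n k p :: nat
    and M :: "'w measure" and \<Omega> :: "'w \<Rightarrow> real mat" and \<omega> :: 'w
  assumes "A \<in> carrier_mat m n"
    and "1 \<le> k" and "1 \<le> p" and "k + p \<le> min m n"
    and "gaussian_random_matrix M n (k + p) \<Omega>" and "\<omega> \<in> space M"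
    and "randomized_svd A k (\<Omega> \<omega>) P B Ak"
  shows "matrix_2_norm (A - Ak)
           \<le> singular_value B (k + 1) + matrix_2_norm ((1\<^sub>m m - P * transpose_mat P) * A) \<and>
         singular_value A (m - p + 1) \<le> singular_value B (k + 1) \<and>
         singular_value B (k + 1) \<le> singular_value A (k + 1)"
proof -
  define l where "l = k + p"
  note A = assms(1)
  have l: "k < l" "l \<le> m" "l \<le> n" using assms(3,4) by (auto simp: l_def)
  have G: "\<Omega> \<omega> \<in> carrier_mat n l"
    using assms(5,6) by (simp add: gaussian_random_matrix_def l_def)
  obtain R U S V where qr: "compact_qr (A * \<Omega> \<omega>) P R" and B_eq: "B = transpose_mat P * A"
    and svd: "compact_svd B U S V"
    and Ak: "Ak = P * (first_columns k U * leading_block k S * transpose_mat (first_columns k V))"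
    using assms(7) unfolding randomized_svd_def by blast
  have P: "P \<in> carrier_mat m l" "orthonormal_columns P"
    using qr A G by (auto simp: compact_qr_def)
  have B: "B \<in> carrier_mat l n" using P A by (simp add: B_eq)
  have U: "U \<in> carrier_mat l l" "orthonormal_columns U"
    and V: "V \<in> carrier_mat n l" "orthonormal_columns V"
    and S: "S \<in> carrier_mat l l" "diagonal_mat S"
    and S_nonneg: "\<And>i. i < l \<Longrightarrow> 0 \<le> S $$ (i, i)"
    and S_mono: "\<And>i j. i \<le> j \<Longrightarrow> j < l \<Longrightarrow> S $$ (j, j) \<le> S $$ (i, i)"
    and B_svd: "B = U * S * transpose_mat V"
    using B l svd by (auto simp: compact_svd_def Let_def min_def)
  have sigma: "singular_value B (k + 1) = S $$ (k, k)"
    using singular_value_eqI[OF B U compact_svd_gram[OF B l(3) svd] S_nonneg S_mono l(1)] by simp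
  let ?Bk = "first_columns k U * leading_block k S * transpose_mat (first_columns k V)"
  let ?T = "mat_diag l (\<lambda>i. if i < k then 0 else S $$ (i, i))"
  have Bk: "?Bk \<in> carrier_mat l n"
    using U V by (intro carrier_matI) (simp_all add: first_columns_def)
  have diff: "B - ?Bk = U * ?T * transpose_mat V"
    unfolding B_svd using truncated_svd[OF U(1) V(1) S] l by simp
  have "euclidean_norm ((transpose_mat P * A - ?Bk) *\<^sub>v x) \<le> S $$ (k, k)"
    if x: "x \<in> carrier_vec n" and x1: "euclidean_norm x \<le> 1" for x
  proof -
    let ?y = "transpose_mat V *\<^sub>v x"
    have y: "?y \<in> carrier_vec l" using V x by simp
    have Ty: "?T *\<^sub>v ?y \<in> carrier_vec l" using y by (simp add: mult_mat_vec_carrier[OF mat_diag_dim])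
    have "(transpose_mat P * A - ?Bk) *\<^sub>v x = U *\<^sub>v (?T *\<^sub>v ?y)"
    proof -
      have "(U * ?T * transpose_mat V) *\<^sub>v x = (U * ?T) *\<^sub>v ?y"
        using U V x mult_carrier_mat[OF U(1) mat_diag_dim] by (intro assoc_mult_mat_vec[of _ l l _ n]) auto
      also have "\<dots> = U *\<^sub>v (?T *\<^sub>v ?y)"
        by (rule assoc_mult_mat_vec[OF U(1) mat_diag_dim y])
      finally show ?thesis using diff by (simp add: B_eq)
    qed
    then have "euclidean_norm ((transpose_mat P * A - ?Bk) *\<^sub>v x) = euclidean_norm (?T *\<^sub>v ?y)"
      using orthonormal_columns_norm[OF U Ty] by simp
    also have "\<dots> \<le> S $$ (k, k) * euclidean_norm ?y"
      using S_nonneg S_mono l by (intro norm_mat_diag_mult_le y) auto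
    also have "\<dots> \<le> S $$ (k, k) * 1"
      using orthonormal_columns_transpose_norm_le[OF V x] x1 S_nonneg l
      by (intro mult_left_mono) auto
    finally show ?thesis by simp
  qed
  from projection_error_le[OF A P Bk this]
  have "matrix_2_norm (A - Ak)
      \<le> singular_value B (k + 1) + matrix_2_norm ((1\<^sub>m m - P * transpose_mat P) * A)"
    by (simp only: Ak sigma)
  moreover have "k + (m - l) = m - p" using l by (simp add: l_def)
  ultimately show ?thesis
    using singular_value_compression[OF A P l(2,1)] by (simp add: B_eq)
qed

end
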